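(* For every integer $k\ge 3$, the permutation quandle $\mathbb{P}_k$, which is finite, involutive and connected, has at least one irreducible strong complex representation of dimension larger than one. (In particular, it is not true that every strong irreducible representation of a finite connected involutive rack is one-dimensional.)
   Context: A rack is a set $X$ with a binary operation $\vartriangleright$ such that for every $x\in X$ the map $L_x:X\to X$, $L_x(y)=x\vartriangleright y$, is bijective, and $x\vartriangleright(y\vartriangleright z)=(x\vartriangleright y)\vartriangleright(x\vartriangleright z)$ for all $x,y,z\in X$; it is a quandle if also $x\vartriangleright x=x$ for all $x$. A rack is involutive if $L_x\circ L_x=\mathrm{id}$ for all $x$. A rack homomorphism is a map preserving $\vartriangleright$. For a group $G$, $Conj(G)$ is the quandle on the set $G$ with $g\vartriangleright h=ghg^{-1}$. A rack $X$ is connected if the group of permutations of $X$ generated by all $L_x$, $x\in X$, acts transitively on $X$. For $k\ge3$, the permutation quandle $\mathbb{P}_k$ is the subquandle of $Conj(\mathbb{S}_k)$ consisting of all transpositions of the symmetric group $\mathbb{S}_k$. A representation of a rack $X$ on a vector space $V$ is a rack homomorphism $\rho:X\to Conj(GL(V))$, $x\mapsto\rho_x$. It is irreducible if the only subspaces $W\subseteq V$ with $\rho_x(W)\subseteq W$ for all $x\in X$ are $\{0\}$ and $V$ (with $V\neq 0$). A stabilizing family of $X$ is a finite family (sequence, repetitions allowed) $u_1,\dots,u_m$ of elements of $X$ with $L_{u_m}\cdots L_{u_1}=\mathrm{id}$. The representation $\rho$ is strong if $\rho_{u_m}\cdots\rho_{u_1}=\mathrm{id}$ for every stabilizing family $u_1,\dots,u_m$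 of $X$. *)

theory Defs
  imports
    Complex_Main
    "HOL-Library.Function_Algebras"
    "HOL-Algebra.Bij"
    "HOL-Algebra.Generated_Groups"
    "HOL-Algebra.Sym_Groups"
begin

section \<open>Racks and quandles\<close>

record 'a rack = "'a partial_object" +
  rop :: "'a \<Rightarrow> 'a \<Rightarrow> 'a"  (infixl \<open>\<triangleright>\<index>\<close> 70)

locale rack =
  fixes X (structure)
  assumes bij_left: "x \<in> carrier X \<Longrightarrow> bij_betw (\<lambda>y. x \<triangleright> y) (carrier X) (carrier X)"
    and self_distrib: "\<lbrakk>x \<in> carrier X; y \<in> carrier X; z \<in> carrier X\<rbrakk>
      \<Longrightarrow> x \<triangleright> (y \<triangleright> z) = (x \<triangleright> y) \<triangleright> (x \<triangleright> z)"

locale quandle = rack +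
  assumes idem: "x \<in> carrier X \<Longrightarrow> x \<triangleright> x = x"

text \<open>The left translation is made extensional, so that it is an element of
  \<open>BijGroup (carrier X)\<close>, the group of permutations of the underlying set.\<close>

definition left_trans :: "('a, 'm) rack_scheme \<Rightarrow> 'a \<Rightarrow> 'a \<Rightarrow> 'a" where
  "left_trans X x = (\<lambda>y \<in> carrier X. x \<triangleright>\<^bsub>X\<^esub> y)"

locale involutive_rack = rack +
  assumes involutive: "x \<in> carrier X
    \<Longrightarrow> left_trans X x \<otimes>\<^bsub>BijGroup (carrier X)\<^esub> left_trans X x = \<one>\<^bsub>BijGroup (carrier X)\<^esub>"

definition inner_group :: "('a, 'm) rack_scheme \<Rightarrow> ('a \<Rightarrow> 'a) set" where
  "inner_group X = generate (BijGroup (carrier X)) (left_trans X ` carrier X)"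

locale connected_rack = rack +
  assumes transitive: "\<lbrakk>x \<in> carrier X; y \<in> carrier X\<rbrakk> \<Longrightarrow> \<exists>\<phi> \<in> inner_group X. \<phi> x = y"

definition rack_hom :: "('a, 'm) rack_scheme \<Rightarrow> ('b, 'n) rack_scheme \<Rightarrow> ('a \<Rightarrow> 'b) set" where
  "rack_hom X Y = {f \<in> carrier X \<rightarrow> carrier Y.
     \<forall>x \<in> carrier X. \<forall>y \<in> carrier X. f (x \<triangleright>\<^bsub>X\<^esub> y) = f x \<triangleright>\<^bsub>Y\<^esub> f y}"

definition Conj :: "('a, 'm) monoid_scheme \<Rightarrow> 'a rack" where
  "Conj G = \<lparr>carrier = carrier G, rop = (\<lambda>g h. g \<otimes>\<^bsub>G\<^esub> h \<otimes>\<^bsub>G\<^esub> inv\<^bsub>G\<^esub> g)\<rparr>"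

definition perm_quandle :: "nat \<Rightarrow> (nat \<Rightarrow> nat) rack" where
  "perm_quandle k = (Conj (sym_group k))
     \<lparr>carrier := {transpose i j | i j. i \<in> {1..k} \<and> j \<in> {1..k} \<and> i \<noteq> j}\<rparr>"


section \<open>Representations of racks\<close>

text \<open>The vector space is a subset \<open>V\<close> (a subspace, see \<open>rack_representation\<close>) of an ambient
  type; elements of \<open>GL V\<close> are extensional functions on \<open>V\<close>.\<close>

definition GL :: "('f \<Rightarrow> 'v \<Rightarrow> 'v) \<Rightarrow> 'v set \<Rightarrow> ('v::ab_group_add \<Rightarrow> 'v) monoid" where
  "GL scale V = (BijGroup V)
     \<lparr>carrier := {f \<in> Bij V. (\<forall>v \<in> V. \<forall>w \<in> V. f (v + w) = f v + f w) \<and>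
                             (\<forall>c. \<forall>v \<in> V. f (scale c v) = scale c (f v))}\<rparr>"

text \<open>For \<open>us = [u\<^sub>1, \<dots>, u\<^sub>m]\<close> this is the product of \<open>f u\<^sub>m, \<dots>, f u\<^sub>1\<close>, in this order.\<close>

definition rev_prod :: "('b, 'm) monoid_scheme \<Rightarrow> ('a \<Rightarrow> 'b) \<Rightarrow> 'a list \<Rightarrow> 'b" where
  "rev_prod G f us = fold (\<lambda>u g. f u \<otimes>\<^bsub>G\<^esub> g) us \<one>\<^bsub>G\<^esub>"

definition stabilizing_family :: "('a, 'm) rack_scheme \<Rightarrow> 'a list \<Rightarrow> bool" where
  "stabilizing_family X us \<longleftrightarrow> set us \<subseteq> carrier X \<and>
     rev_prod (BijGroup (carrier X)) (left_trans X) us = \<one>\<^bsub>BijGroup (carrier X)\<^esub>"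

locale rack_representation = rack X + vector_space scale
  for X :: "('a, 'm) rack_scheme" (structure)
    and scale :: "'f::field \<Rightarrow> 'v::ab_group_add \<Rightarrow> 'v" +
  fixes V :: "'v set" and \<rho> :: "'a \<Rightarrow> 'v \<Rightarrow> 'v"
  assumes subspace_V: "subspace V"
    and hom: "\<rho> \<in> rack_hom X (Conj (GL scale V))"

locale irreducible_rack_representation = rack_representation +
  assumes nontrivial: "V \<noteq> {0}"
    and irreducible: "\<lbrakk>subspace W; W \<subseteq> V; \<And>x. x \<in> carrier X \<Longrightarrow> \<rho> x ` W \<subseteq> W\<rbrakk>
      \<Longrightarrow> W = {0} \<or> W = V"

locale strong_rack_representation = rack_representation +
  assumes strong: "stabilizing_family X us \<Longrightarrow> rev_prod (GL scale V) \<rho> us = \<one>\<^bsub>GL scale V\<^esub>"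


section \<open>The ambient complex vector space\<close>

text \<open>Every complex vector space of at most countable dimension is isomorphic to a subspace of the
  space of complex sequences, with pointwise operations.\<close>

definition cscale :: "complex \<Rightarrow> (nat \<Rightarrow> complex) \<Rightarrow> nat \<Rightarrow> complex" where
  "cscale c v = (\<lambda>i. c * v i)"

lemma vector_space_cscale: "vector_space cscale"
  by unfold_locales (auto simp: cscale_def fun_eq_iff algebra_simps)

end

theory Submission
  imports Defs
begin

text \<open>
  The witness is the standard representation of the symmetric group \<open>S\<^sub>k\<close>: coordinate permutations
  of the vectors supported on \<open>{1..k}\<close> whose coordinates sum to zero. Composed with the inclusion
  of the transpositions, every linear representation of \<open>S\<^sub>k\<close> is a representation of the rack of
  transpositions, because group homomorphisms respect conjugation.

  Irreducibility (\<open>standard_rep_irreducible\<close>) uses only transpositions: if \<open>v\<close> is a nonzero vector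
  of sum zero, two of its coordinates differ, say \<open>v a \<noteq> v b\<close>, and subtracting from \<open>v\<close> its image
  under the transposition of \<open>a\<close> and \<open>b\<close> leaves a nonzero multiple of \<open>e\<^sub>a - e\<^sub>b\<close>. Transpositions
  carry this vector to all differences \<open>e\<^sub>i - e\<^sub>j\<close>, and these span the space; the \<open>k - 1\<close>
  differences \<open>e\<^sub>i - e\<^sub>k\<close> with \<open>i < k\<close> form a basis, so that for
  \<open>k \<ge> 3\<close> the dimension exceeds one.

  Strength (\<open>conj_rack_hom_strong\<close>) is a statement about centralizers. In a rack formed by a
  conjugation invariant subset \<open>T\<close> of a group, \<open>x \<mapsto> L\<^sub>x\<close> is the restriction to \<open>T\<close> of the
  conjugation action of the whole group, so that \<open>u\<^sub>1, \<dots>, u\<^sub>m\<close> is a stabilizing family if and only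
  if the product \<open>u\<^sub>m \<cdots> u\<^sub>1\<close> centralizes \<open>T\<close>. For \<open>k \<ge> 3\<close> only the identity commutes with all
  transpositions (\<open>centralizer_transpositions_trivial\<close>). The product of a stabilizing family is
  therefore the identity, and so is its image under any homomorphism.
\<close>


section \<open>Racks of conjugation in a group\<close>

abbreviation conj_rack :: "('a, 'm) monoid_scheme \<Rightarrow> 'a set \<Rightarrow> 'a rack" where
  "conj_rack G T \<equiv> (Conj G)\<lparr>carrier := T\<rparr>"

lemma Conj_op:
  "x \<triangleright>\<^bsub>Conj G\<^esub> y = x \<otimes>\<^bsub>G\<^esub> y \<otimes>\<^bsub>G\<^esub> inv\<^bsub>G\<^esub> x"
  by (simp add: Conj_def)

lemma BijGroup_mult:
  "\<lbrakk>f \<in> Bij S; g \<in> Bij S\<rbrakk> \<Longrightarrow> f \<otimes>\<^bsub>BijGroup S\<^esub> g = compose S f g"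
  by (simp add: BijGroup_def)

text \<open>Bijectivity comes for free when a group acts: the inverse element acts as the inverse map.\<close>

lemma (in group) action_hom_BijGroup:
  assumes ext: "\<And>g. g \<in> carrier G \<Longrightarrow> \<phi> g \<in> extensional S"
    and maps: "\<And>g s. \<lbrakk>g \<in> carrier G; s \<in> S\<rbrakk> \<Longrightarrow> \<phi> g s \<in> S"
    and one: "\<And>s. s \<in> S \<Longrightarrow> \<phi> \<one> s = s"
    and mult: "\<And>g h s. \<lbrakk>g \<in> carrier G; h \<in> carrier G; s \<in> S\<rbrakk> \<Longrightarrow> \<phi> (g \<otimes> h) s = \<phi> g (\<phi> h s)"
  shows "\<phi> \<in> hom G (BijGroup S)"
proof (rule homI)
  have inv_left: "\<phi> (inv g) (\<phi> g s) = s" if "g \<in> carrier G" "s \<in> S" for g s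
    using that mult[of "inv g" g s] one by simp
  have inv_right: "\<phi> g (\<phi> (inv g) s) = s" if "g \<in> carrier G" "s \<in> S" for g s
    using that mult[of g "inv g" s] one by simp
  have Bij: "\<phi> g \<in> Bij S" if g: "g \<in> carrier G" for g
  proof -
    have "bij_betw (\<phi> g) S S"
      by (rule bij_betw_byWitness[where f' = "\<phi> (inv g)"])
        (use g maps inv_left inv_right in auto)
    with ext[OF g] show ?thesis by (simp add: Bij_def)
  qed
  show "\<phi> g \<in> carrier (BijGroup S)" if "g \<in> carrier G" for g
    using Bij[OF that] by (simp add: BijGroup_def)
  show "\<phi> (g \<otimes> h) = \<phi> g \<otimes>\<^bsub>BijGroup S\<^esub> \<phi> h" if "g \<in> carrier G" "h \<in> carrier G" for g h
  proof -
    have "\<phi> (g \<otimes> h) = compose S (\<phi> g) (\<phi> h)"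
      by (rule extensionalityI[of _ S]) (use that ext mult in \<open>auto simp: compose_eq\<close>)
    with that show ?thesis by (simp add: Bij BijGroup_mult)
  qed
qed

lemma (in group_hom) rev_prod_hom:
  assumes "set us \<subseteq> carrier G"
  shows "rev_prod G (\<lambda>u. u) us \<in> carrier G \<and>
         rev_prod H h us = h (rev_prod G (\<lambda>u. u) us)"
  using assms by (induction us rule: rev_induct) (auto simp: rev_prod_def)

lemma hom_imp_rack_hom:
  assumes "group_hom G H h" and "T \<subseteq> carrier G"
  shows "h \<in> rack_hom (conj_rack G T) (Conj H)"
proof -
  interpret group_hom G H h by fact
  show ?thesis
    using assms(2) by (auto simp: rack_hom_def Conj_def subset_iff)
qed

locale conj_invariant = group G for G (structure) +
  fixes T :: "'a set"
  assumes subset: "T \<subseteq> carrier G"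
    and conj_closed: "\<lbrakk>g \<in> carrier G; t \<in> T\<rbrakk> \<Longrightarrow> g \<otimes> t \<otimes> inv g \<in> T"
begin

lemma in_carrier: "t \<in> T \<Longrightarrow> t \<in> carrier G"
  using subset by blast

text \<open>The left translation by \<open>x\<close> makes sense, as conjugation, for all \<open>x\<close> in the group and not only
  for \<open>x\<close> in the rack. This extension is what turns \<open>x \<mapsto> L\<^sub>x\<close> into a group homomorphism.\<close>

lemma left_trans_group_hom: "group_hom G (BijGroup T) (left_trans (conj_rack G T))"
proof -
  have "left_trans (conj_rack G T) \<in> hom G (BijGroup T)"
  proof (rule action_hom_BijGroup)
    fix g h s assume gh: "g \<in> carrier G" "h \<in> carrier G" and s: "s \<in> T"
    have "(g \<otimes> h) \<otimes> s \<otimes> inv (g \<otimes> h) = g \<otimes> (h \<otimes> s \<otimes> inv h) \<otimes> inv g"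
      using gh in_carrier[OF s] by (simp add: inv_mult_group m_assoc)
    then show "left_trans (conj_rack G T) (g \<otimes> h) s =
        left_trans (conj_rack G T) g (left_trans (conj_rack G T) h s)"
      using gh s conj_closed by (simp add: left_trans_def Conj_op)
  qed (auto simp: left_trans_def Conj_op conj_closed in_carrier)
  then show ?thesis
    by (simp add: group_hom_def group_hom_axioms_def group_BijGroup)
qed

sublocale left_trans: group_hom G "BijGroup T" "left_trans (conj_rack G T)"
  by (rule left_trans_group_hom)

lemma left_trans_apply:
  "t \<in> T \<Longrightarrow> left_trans (conj_rack G T) g t = g \<otimes> t \<otimes> inv g"
  by (simp add: left_trans_def Conj_op)

lemma conj_rack_quandle: "quandle (conj_rack G T)"
proof unfold_locales
  fix x assume "x \<in> carrier (conj_rack G T)"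
  then have x: "x \<in> T" by simp
  have "bij_betw (left_trans (conj_rack G T) x) T T"
    using left_trans.hom_closed[OF in_carrier[OF x]] by (simp add: BijGroup_def Bij_def)
  moreover have "bij_betw (left_trans (conj_rack G T) x) T T \<longleftrightarrow>
      bij_betw (\<lambda>y. x \<triangleright>\<^bsub>conj_rack G T\<^esub> y) T T"
    by (rule bij_betw_cong) (simp add: left_trans_def)
  ultimately show "bij_betw (\<lambda>y. x \<triangleright>\<^bsub>conj_rack G T\<^esub> y)
      (carrier (conj_rack G T)) (carrier (conj_rack G T))"
    by simp
  show "x \<triangleright>\<^bsub>conj_rack G T\<^esub> x = x"
    using in_carrier[OF x] by (simp add: Conj_op m_assoc)
next
  fix x y z
  assume "x \<in> carrier (conj_rack G T)" "y \<in> carrier (conj_rack G T)" "z \<in> carrier (conj_rack G T)"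
  then have xyz: "x \<in> carrier G" "y \<in> carrier G" "z \<in> carrier G"
    using in_carrier by auto
  have cancel: "inv x \<otimes> (x \<otimes> w) = w" if "w \<in> carrier G" for w
    using xyz that by (simp add: m_assoc[symmetric])
  show "x \<triangleright>\<^bsub>conj_rack G T\<^esub> (y \<triangleright>\<^bsub>conj_rack G T\<^esub> z) =
      (x \<triangleright>\<^bsub>conj_rack G T\<^esub> y) \<triangleright>\<^bsub>conj_rack G T\<^esub> (x \<triangleright>\<^bsub>conj_rack G T\<^esub> z)"
    using xyz by (simp add: Conj_op inv_mult_group m_assoc cancel)
qed

lemma conj_rack_rack: "rack (conj_rack G T)"
  using conj_rack_quandle by (rule quandle.axioms)

lemma conj_rack_involutive:
  assumes "\<And>t. t \<in> T \<Longrightarrow> t \<otimes> t = \<one>"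
  shows "involutive_rack (conj_rack G T)"
proof -
  have "left_trans (conj_rack G T) x \<otimes>\<^bsub>BijGroup T\<^esub> left_trans (conj_rack G T) x
      = \<one>\<^bsub>BijGroup T\<^esub>" if "x \<in> T" for x
    using assms[OF that] left_trans.hom_mult[of x x] in_carrier[OF that] by simp
  with conj_rack_rack show ?thesis
    by (simp add: involutive_rack_def involutive_rack_axioms_def)
qed

text \<open>Restricted to \<open>T\<close>, a representation of \<open>G\<close> sends a family with product \<open>g\<close> to a family with
  product \<open>h g\<close>. The family is stabilizing if and only if \<open>g\<close> acts trivially on \<open>T\<close> by conjugation,
  so a trivial centralizer makes every representation strong.\<close>

lemma conj_rack_hom_strong:
  fixes us :: "'a list"
  assumes h: "group_hom G H h"
    and centralizer: "\<And>g. \<lbrakk>g \<in> carrier G; \<And>t. t \<in> T \<Longrightarrow> g \<otimes> t \<otimes> inv g = t\<rbrakk> \<Longrightarrow> g = \<one>"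
    and us: "stabilizing_family (conj_rack G T) us"
  shows "rev_prod H h us = \<one>\<^bsub>H\<^esub>"
proof -
  interpret h: group_hom G H h by fact
  define g where "g = rev_prod G (\<lambda>u. u) us"
  have us_G: "set us \<subseteq> carrier G"
    using us subset by (auto simp: stabilizing_family_def)
  have g: "g \<in> carrier G" and hg: "rev_prod H h us = h g"
    using h.rev_prod_hom[OF us_G] by (auto simp: g_def)
  have "left_trans (conj_rack G T) g = \<one>\<^bsub>BijGroup T\<^esub>"
    using left_trans.rev_prod_hom[OF us_G] us by (simp add: g_def stabilizing_family_def)
  then have "left_trans (conj_rack G T) g t = t" if "t \<in> T" for t
    using that by (simp add: BijGroup_def)
  then have "g = \<one>"
    using g centralizer left_trans_apply by metis
  with hg show ?thesis by simp
qed

end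


section \<open>The quandle of transpositions\<close>

definition transpositions :: "nat \<Rightarrow> (nat \<Rightarrow> nat) set" where
  "transpositions k = {transpose i j | i j. i \<in> {1..k} \<and> j \<in> {1..k} \<and> i \<noteq> j}"

lemma perm_quandle_conj_rack: "perm_quandle k = conj_rack (sym_group k) (transpositions k)"
  by (simp add: perm_quandle_def transpositions_def)

lemma transpose_in_sym_group:
  "\<lbrakk>i \<in> {1..k}; j \<in> {1..k}\<rbrakk> \<Longrightarrow> transpose i j \<in> carrier (sym_group k)"
  by (simp add: sym_group_carrier permutes_swap_id)

lemma conj_transpose: "bij p \<Longrightarrow> p \<circ> transpose i j \<circ> inv' p = transpose (p i) (p j)"
  using transpose_comp_eq[of p "p i" "p j"]
  by (simp add: fun_eq_iff bij_is_inj bij_is_surj surj_f_inv_f flip: comp_assoc) (metis bij_is_surj surj_f_inv_f)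

lemma conj_transpose_sym_group:
  assumes "p \<in> carrier (sym_group k)"
  shows "p \<otimes>\<^bsub>sym_group k\<^esub> transpose i j \<otimes>\<^bsub>sym_group k\<^esub> inv\<^bsub>sym_group k\<^esub> p = transpose (p i) (p j)"
  using assms permutes_bij[of p] by (simp add: sym_group_mult sym_group_carrier conj_transpose)

lemma conj_invariant_transpositions: "conj_invariant (sym_group k) (transpositions k)"
proof -
  have "transpose (p i) (p j) \<in> transpositions k"
    if "p \<in> carrier (sym_group k)" "i \<in> {1..k}" "j \<in> {1..k}" "i \<noteq> j" for p i j
  proof -
    have p: "p permutes {1..k}"
      using that by (simp add: sym_group_carrier)
    have "p i \<in> {1..k}" "p j \<in> {1..k}" "p i \<noteq> p j"
      using that permutes_in_image[OF p] permutes_inj[OF p] by (auto simp del: atLeastAtMost_iff dest: injD)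
    then show ?thesis
      unfolding transpositions_def by blast
  qed
  then show ?thesis
    unfolding conj_invariant_def conj_invariant_axioms_def
    by (auto simp: transpositions_def sym_group_is_group transpose_in_sym_group conj_transpose_sym_group
        simp del: atLeastAtMost_iff sym_group_inv_equality)
qed

interpretation perm: conj_invariant "sym_group k" "transpositions k" for k
  by (rule conj_invariant_transpositions)

lemma finite_perm_quandle: "finite (carrier (perm_quandle k))"
proof -
  have "transpositions k \<subseteq> (\<lambda>(i, j). transpose i j) ` ({1..k} \<times> {1..k})"
    by (force simp: transpositions_def)
  then show ?thesis
    by (simp add: perm_quandle_conj_rack finite_subset)
qed

lemma perm_quandle_involutive: "involutive_rack (perm_quandle k)"
  unfolding perm_quandle_conj_rack
  by (rule perm.conj_rack_involutive) (auto simp: transpositions_def sym_group_mult sym_group_one)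

text \<open>A product of two transpositions, either of which may degenerate to the identity, carries any
  pair of distinct points to any other such pair, and conjugation by it carries the transposition
  of the first pair to that of the second.\<close>

lemma perm_quandle_connected: "connected_rack (perm_quandle k)"
proof -
  define X where "X = perm_quandle k"
  have X: "X = conj_rack (sym_group k) (transpositions k)"
    by (simp add: X_def perm_quandle_conj_rack)
  have gen: "left_trans X (transpose i j) \<in> inner_group X" if "i \<in> {1..k}" "j \<in> {1..k}" for i j
  proof (cases "i = j")
    case True
    have "left_trans X id = \<one>\<^bsub>BijGroup (carrier X)\<^esub>"
      using perm.left_trans.hom_one[of k] by (simp add: X sym_group_one)
    with True show ?thesis
      by (simp add: inner_group_def generate.one)
  next
    case False
    with that have "transpose i j \<in> carrier X"
      by (auto simp: X transpositions_def)
    then show ?thesis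
      by (auto simp: inner_group_def intro: generate.incl)
  qed
  have "\<exists>\<phi>\<in>inner_group X. \<phi> x = y" if xy: "x \<in> carrier X" "y \<in> carrier X" for x y
  proof -
    obtain i j where x: "x = transpose i j" and ij: "i \<in> {1..k}" "j \<in> {1..k}" "i \<noteq> j"
      using xy(1) by (auto simp: X transpositions_def)
    obtain a b where y: "y = transpose a b" and ab: "a \<in> {1..k}" "b \<in> {1..k}" "a \<noteq> b"
      using xy(2) by (auto simp: X transpositions_def)
    define c where "c = transpose i a j"
    have c: "c \<in> {1..k}" "c \<noteq> a"
      using ij ab by (auto simp: c_def transpose_def)
    define p where "p = transpose b c \<circ> transpose i a"
    have p_val: "p i = a" "p j = b"
      using ab c by (auto simp: p_def c_def[symmetric])
    have trs: "transpose b c \<in> carrier (sym_group k)" "transpose i a \<in> carrier (sym_group k)"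
      using ij ab c by (auto intro: transpose_in_sym_group simp del: atLeastAtMost_iff)
    then have p: "p \<in> carrier (sym_group k)"
      unfolding p_def using group.is_monoid[OF sym_group_is_group, of k] monoid.m_closed
      by (fastforce simp: sym_group_mult[of k, symmetric])
    have "left_trans X p = left_trans X (transpose b c) \<otimes>\<^bsub>BijGroup (carrier X)\<^esub> left_trans X (transpose i a)"
      using perm.left_trans.hom_mult[OF trs] by (simp add: X p_def sym_group_mult)
    also have "\<dots> \<in> inner_group X"
      using gen[OF ab(2) c(1)] gen[OF ij(1) ab(1)] by (auto simp: inner_group_def intro: generate.eng)
    finally have "left_trans X p \<in> inner_group X" .
    moreover have "left_trans X p x = y"
      using p xy(1) unfolding X x y
      by (simp add: perm.left_trans_apply conj_transpose_sym_group p_val del: sym_group_inv_equality)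
    ultimately show ?thesis by blast
  qed
  moreover have "rack X"
    unfolding X by (rule perm.conj_rack_rack)
  ultimately show ?thesis
    unfolding X_def[symmetric] connected_rack_def connected_rack_axioms_def by blast
qed

text \<open>A permutation that commutes with all transpositions preserves every two-element subset of
  \<open>{1..k}\<close>. Two such subsets sharing only the point \<open>i\<close> exist when \<open>k \<ge> 3\<close>, and force \<open>i\<close> to be
  fixed.\<close>

lemma centralizer_transpositions_trivial:
  assumes k: "k \<ge> 3" and p: "p \<in> carrier (sym_group k)"
    and comm: "\<And>t. t \<in> transpositions k \<Longrightarrow>
      p \<otimes>\<^bsub>sym_group k\<^esub> t \<otimes>\<^bsub>sym_group k\<^esub> inv\<^bsub>sym_group k\<^esub> p = t"
  shows "p = \<one>\<^bsub>sym_group k\<^esub>"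
proof -
  have pair: "p i = i \<or> p i = j" if "i \<in> {1..k}" "j \<in> {1..k}" "i \<noteq> j" for i j
  proof -
    have "transpose i j \<in> transpositions k"
      using that unfolding transpositions_def by blast
    from comm[OF this] have eq: "transpose (p i) (p j) = transpose i j"
      by (simp add: conj_transpose_sym_group[OF p] del: sym_group_inv_equality)
    have "inj p"
      using p permutes_inj by (auto simp: sym_group_carrier)
    then have "transpose (p i) (p j) (p i) \<noteq> p i"
      using that by (auto dest: injD)
    then show ?thesis
      unfolding eq by (metis transpose_apply_other)
  qed
  have "p i = i" for i
  proof (cases "i \<in> {1..k}")
    case True
    have "card ({1..k} - {i}) \<ge> 2"
      using True k by simp
    then obtain j l where "j \<in> {1..k} - {i}" "l \<in> {1..k} - {i}" "j \<noteq> l"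
      by (metis card_le_Suc0_iff_eq finite_Diff finite_atLeastAtMost not_less_eq_eq numeral_2_eq_2)
    then show ?thesis
      using pair[of i j] pair[of i l] True by auto
  next
    case False
    then show ?thesis
      using p permutes_not_in by (fastforce simp: sym_group_carrier)
  qed
  then show ?thesis
    by (simp add: fun_eq_iff sym_group_one)
qed


section \<open>General linear groups\<close>

lemma (in vector_space) group_GL:
  assumes V: "subspace V"
  shows "group (GL scale V)"
proof -
  let ?C = "carrier (GL scale V)"
  have C: "f \<in> ?C \<longleftrightarrow> f \<in> Bij V \<and> (\<forall>v\<in>V. \<forall>w\<in>V. f (v + w) = f v + f w) \<and>
      (\<forall>c. \<forall>v\<in>V. f (scale c v) = scale c (f v))" for f
    by (auto simp: GL_def)
  note mem = subspace_add[OF V] subspace_scale[OF V]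
  have "subgroup ?C (BijGroup V)"
  proof (rule group.subgroupI[OF group_BijGroup])
    show "?C \<subseteq> carrier (BijGroup V)"
      by (auto simp: C BijGroup_def)
    have "(\<lambda>v\<in>V. v) \<in> ?C"
      by (simp add: C id_Bij mem)
    then show "?C \<noteq> {}" by blast
  next
    fix f assume f: "f \<in> ?C"
    then have Bij: "f \<in> Bij V" by (simp add: C)
    have onto: "f ` V = V"
      using Bij by (simp add: Bij_def bij_betw_def)
    have inv_scale: "inv_into V f (scale c v) = scale c (inv_into V f v)" if v: "v \<in> V" for c v
    proof -
      obtain w where w: "w \<in> V" "v = f w"
        using onto v by blast
      have "scale c v = f (scale c w)"
        using f w by (simp add: C)
      moreover have "inj_on f V"
        using Bij by (simp add: Bij_def bij_betw_def)
      ultimately show ?thesis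
        using w by (simp add: mem)
    qed
    have inv_add: "inv_into V f (v + w) = inv_into V f v + inv_into V f w" if "v \<in> V" "w \<in> V" for v w
      by (rule Bij_inv_into_lemma[where g = "(+)"]) (use f Bij that in \<open>simp_all add: C mem\<close>)
    show "inv\<^bsub>BijGroup V\<^esub> f \<in> ?C"
      by (simp add: C mem inv_BijGroup[OF Bij] restrict_inv_into_Bij[OF Bij] inv_scale inv_add)
  next
    fix f g assume fg: "f \<in> ?C" "g \<in> ?C"
    then have "f \<in> Bij V" "g \<in> Bij V" "g \<in> V \<rightarrow> V"
      by (auto simp: C dest: Bij_imp_funcset)
    then show "f \<otimes>\<^bsub>BijGroup V\<^esub> g \<in> ?C"
      using fg by (simp add: C mem BijGroup_mult compose_Bij compose_eq Pi_iff)
  qed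
  then have "group ((BijGroup V)\<lparr>carrier := ?C\<rparr>)"
    by (rule subgroup.subgroup_is_group) (rule group_BijGroup)
  then show ?thesis
    by (simp add: GL_def)
qed


section \<open>The standard representation of the symmetric group\<close>

interpretation cvs: vector_space cscale
  by (rule vector_space_cscale)

definition zero_sum :: "nat \<Rightarrow> (nat \<Rightarrow> complex) set" where
  "zero_sum k = {v. (\<forall>i. i \<notin> {1..k} \<longrightarrow> v i = 0) \<and> (\<Sum>i\<in>{1..k}. v i) = 0}"

definition standard_rep :: "nat \<Rightarrow> (nat \<Rightarrow> nat) \<Rightarrow> (nat \<Rightarrow> complex) \<Rightarrow> nat \<Rightarrow> complex" where
  "standard_rep k p = (\<lambda>v\<in>zero_sum k. v \<circ> inv' p)"

definition unit_diff :: "nat \<Rightarrow> nat \<Rightarrow> nat \<Rightarrow> complex" where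
  "unit_diff i j = (\<lambda>n. of_bool (n = i) - of_bool (n = j))"

lemma subspace_zero_sum: "cvs.subspace (zero_sum k)"
  by (auto simp: cvs.subspace_def zero_sum_def cscale_def sum.distrib sum_distrib_left[symmetric])

lemma unit_diff_in_zero_sum:
  assumes "i \<in> {1..k}" "j \<in> {1..k}"
  shows "unit_diff i j \<in> zero_sum k"
  using assms by (auto simp: zero_sum_def unit_diff_def sum_subtractf of_bool_def)

lemma zero_sum_permute:
  assumes v: "v \<in> zero_sum k" and p: "p permutes {1..k}"
  shows "v \<circ> inv' p \<in> zero_sum k"
proof -
  have q: "inv' p permutes {1..k}"
    by (rule permutes_inv[OF p])
  have "(\<Sum>i\<in>{1..k}. v (inv' p i)) = (\<Sum>i\<in>{1..k}. v i)"
    using sum.permute[OF q, of v] by (simp add: comp_def)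
  moreover have "v (inv' p i) = 0" if "i \<notin> {1..k}" for i
    using that v permutes_not_in[OF q] by (simp add: zero_sum_def)
  ultimately show ?thesis
    using v by (simp add: zero_sum_def)
qed

lemma standard_rep_group_hom:
  "group_hom (sym_group k) (GL cscale (zero_sum k)) (standard_rep k)"
proof -
  have inv_comp: "inv' (p \<circ> q) = inv' q \<circ> inv' p"
    if "p permutes {1..k}" "q permutes {1..k}" for p q
    using that by (simp add: o_inv_distrib permutes_bij)
  have hom: "standard_rep k \<in> hom (sym_group k) (BijGroup (zero_sum k))"
    by (rule group.action_hom_BijGroup[OF sym_group_is_group])
      (auto simp: standard_rep_def sym_group_carrier sym_group_one sym_group_mult
        zero_sum_permute inv_comp comp_assoc)
  have linear: "standard_rep k p \<in> carrier (GL cscale (zero_sum k))"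
    if "p \<in> carrier (sym_group k)" for p
  proof -
    have "standard_rep k p \<in> Bij (zero_sum k)"
      using hom_in_carrier[OF hom that] by (simp add: BijGroup_def)
    moreover have "standard_rep k p (v + w) = standard_rep k p v + standard_rep k p w"
      if "v \<in> zero_sum k" "w \<in> zero_sum k" for v w
      using that cvs.subspace_add[OF subspace_zero_sum that]
      by (simp add: standard_rep_def fun_eq_iff)
    moreover have "standard_rep k p (cscale c v) = cscale c (standard_rep k p v)"
      if "v \<in> zero_sum k" for c v
    proof -
      have "standard_rep k p (cscale c v) = cscale c v \<circ> inv' p"
        using cvs.subspace_scale[OF subspace_zero_sum that] by (simp add: standard_rep_def)
      also have "\<dots> = cscale c (standard_rep k p v)"
        using that by (simp add: standard_rep_def cscale_def fun_eq_iff)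
      finally show ?thesis .
    qed
    ultimately show ?thesis
      by (simp add: GL_def)
  qed
  have "standard_rep k \<in> hom (sym_group k) (GL cscale (zero_sum k))"
    using hom linear by (auto simp: hom_def GL_def)
  then show ?thesis
    by (simp add: group_hom_def group_hom_axioms_def sym_group_is_group
        cvs.group_GL[OF subspace_zero_sum])
qed

lemma sum_apply_fun: "(\<Sum>i\<in>A. f i) n = (\<Sum>i\<in>A. f i n)"
  by (induction A rule: infinite_finite_induct) auto

lemma unit_diff_span:
  assumes v: "v \<in> zero_sum k" and k: "k \<ge> 1"
  shows "v = (\<Sum>i\<in>{1..<k}. cscale (v i) (unit_diff i k))"
proof
  fix n
  have split: "{1..k} = insert k {1..<k}"
    using k by auto
  have last: "v k = - (\<Sum>i\<in>{1..<k}. v i)"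
    using v unfolding zero_sum_def split by (simp add: add_eq_0_iff)
  have eval: "(\<Sum>i\<in>{1..<k}. cscale (v i) (unit_diff i k)) n =
      (\<Sum>i\<in>{1..<k}. v i * (of_bool (n = i) - of_bool (n = k)))"
    by (simp add: sum_apply_fun cscale_def unit_diff_def)
  show "v n = (\<Sum>i\<in>{1..<k}. cscale (v i) (unit_diff i k)) n"
  proof (cases "n = k")
    case True
    then show ?thesis
      unfolding eval using last by (simp add: sum_negf)
  next
    case False
    then have "(\<Sum>i\<in>{1..<k}. v i * (of_bool (n = i) - of_bool (n = k))) =
        (\<Sum>i\<in>{1..<k}. if n = i then v i else 0)"
      by (intro sum.cong) auto
    also have "\<dots> = v n"
      using False v by (auto simp: zero_sum_def)
    finally show ?thesis
      unfolding eval by simp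
  qed
qed

lemma dim_zero_sum:
  assumes k: "k \<ge> 1"
  shows "cvs.dim (zero_sum k) = k - 1"
proof (rule cvs.dim_unique)
  let ?B = "(\<lambda>i. unit_diff i k) ` {1..<k}"
  have inj: "inj_on (\<lambda>i. unit_diff i k) {1..<k}"
  proof (rule inj_onI)
    fix i j assume ij: "i \<in> {1..<k}" "j \<in> {1..<k}" "unit_diff i k = unit_diff j k"
    have "unit_diff i k i = unit_diff j k i"
      using ij(3) by simp
    with ij(1,2) show "i = j"
      by (auto simp: unit_diff_def split: if_splits)
  qed
  show "?B \<subseteq> zero_sum k"
    using unit_diff_in_zero_sum by auto
  show "zero_sum k \<subseteq> cvs.span ?B"
  proof
    fix v assume "v \<in> zero_sum k"
    from unit_diff_span[OF this k] show "v \<in> cvs.span ?B"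
      by (metis (no_types, lifting) cvs.span_sum cvs.span_scale cvs.span_base imageI)
  qed
  show "card ?B = k - 1"
    using inj by (simp add: card_image)
  show "cvs.independent ?B"
  proof (rule cvs.independent_if_scalars_zero)
    fix f x assume sum0: "(\<Sum>x\<in>?B. cscale (f x) x) = 0" and "x \<in> ?B"
    then obtain j where j: "j \<in> {1..<k}" "x = unit_diff j k" by blast
    have "0 = (\<Sum>x\<in>?B. cscale (f x) x) j"
      unfolding sum0 by simp
    also have "\<dots> = (\<Sum>i\<in>{1..<k}. f (unit_diff i k) * unit_diff i k j)"
      unfolding sum.reindex[OF inj]
      by (simp add: sum_apply_fun cscale_def)
    also have "\<dots> = (\<Sum>i\<in>{1..<k}. if j = i then f (unit_diff i k) else 0)"
      using j by (intro sum.cong) (auto simp: unit_diff_def)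
    also have "\<dots> = f x"
      using j by simp
    finally show "f x = 0" by simp
  qed simp
qed

text \<open>Subtracting from a vector its image under a transposition isolates a multiple of a single
  difference of unit vectors, so that an invariant subspace with a nonconstant vector contains such
  a difference. Transpositions move it to all the others, and these span.\<close>

lemma standard_rep_irreducible:
  assumes W: "cvs.subspace W" "W \<subseteq> zero_sum k"
    and inv: "\<And>t. t \<in> transpositions k \<Longrightarrow> standard_rep k t ` W \<subseteq> W"
    and nonzero: "v \<in> W" "v \<noteq> 0"
  shows "W = zero_sum k"
proof -
  have swap: "w \<circ> transpose i j \<in> W" if "w \<in> W" "i \<in> {1..k}" "j \<in> {1..k}" for w i j
  proof (cases "i = j")
    case False
    then have "standard_rep k (transpose i j) ` W \<subseteq> W"
      using that by (intro inv) (auto simp: transpositions_def)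
    moreover have "standard_rep k (transpose i j) w = w \<circ> transpose i j"
      using that W(2) by (auto simp: standard_rep_def)
    ultimately show ?thesis
      using that by (metis image_subset_iff)
  qed (use that in simp)
  have v: "v \<in> zero_sum k"
    using nonzero W by blast
  obtain a where a: "a \<in> {1..k}" "v a \<noteq> 0"
    using nonzero v by (auto simp: zero_sum_def fun_eq_iff)
  \<comment> \<open>If all coordinates were equal to \<open>v a\<close>, they would sum to \<open>k * v a \<noteq> 0\<close>.\<close>
  obtain b where b: "b \<in> {1..k}" "v b \<noteq> v a"
  proof (rule ccontr)
    assume "\<not> thesis"
    with that have "\<And>i. i \<in> {1..k} \<Longrightarrow> v i = v a" by blast
    then have "(\<Sum>i\<in>{1..k}. v i) = of_nat k * v a"
      by simp
    with v a show False
      by (auto simp: zero_sum_def)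
  qed
  have "v - (v \<circ> transpose a b) \<in> W"
    using cvs.subspace_diff[OF W(1) nonzero(1) swap[OF nonzero(1) a(1) b(1)]] .
  then have "cscale (1 / (v a - v b)) (v - (v \<circ> transpose a b)) \<in> W"
    by (rule cvs.subspace_scale[OF W(1)])
  also have "cscale (1 / (v a - v b)) (v - (v \<circ> transpose a b)) = unit_diff a b"
    using b by (auto simp: fun_eq_iff cscale_def unit_diff_def transpose_def field_simps)
  finally have ab: "unit_diff a b \<in> W" .
  have "unit_diff i k \<in> W" if i: "i \<in> {1..<k}" for i
  proof -
    have ik: "i \<in> {1..k}" "k \<in> {1..k}" "i \<noteq> k"
      using i by auto
    define c where "c = transpose a i b"
    have c: "c \<in> {1..k}" "c \<noteq> i"
      using a b ik by (auto simp: c_def transpose_def)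
    \<comment> \<open>Moving \<open>a\<close> to \<open>i\<close> takes \<open>b\<close> to \<open>c\<close>; moving \<open>c\<close> to \<open>k\<close> then leaves \<open>i\<close> in place.\<close>
    have "unit_diff a b \<circ> transpose a i \<circ> transpose c k \<in> W"
      using swap[OF swap[OF ab a(1) ik(1)] c(1) ik(2)] .
    also have "unit_diff a b \<circ> transpose a i = unit_diff i c"
      by (auto simp: fun_eq_iff unit_diff_def c_def transpose_def)
    also have "unit_diff i c \<circ> transpose c k = unit_diff i k"
      using c ik by (auto simp: fun_eq_iff unit_diff_def transpose_def)
    finally show ?thesis .
  qed
  moreover have "k \<ge> 1"
    using a by simp
  ultimately have "w \<in> W" if "w \<in> zero_sum k" for w
    using unit_diff_span[OF that] cvs.subspace_sum[OF W(1)] cvs.subspace_scale[OF W(1)]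
    by (metis (no_types, lifting))
  with W(2) show ?thesis by blast
qed

lemma standard_rep_rack_representation:
  "rack_representation (perm_quandle k) cscale (zero_sum k) (standard_rep k)"
  unfolding rack_representation_def rack_representation_axioms_def perm_quandle_conj_rack
  using perm.conj_rack_rack vector_space_cscale subspace_zero_sum
    hom_imp_rack_hom[OF standard_rep_group_hom perm.subset]
  by blast

lemma standard_rep_irreducible_rack_representation:
  assumes k: "k \<ge> 2"
  shows "irreducible_rack_representation (perm_quandle k) cscale (zero_sum k) (standard_rep k)"
proof -
  have "unit_diff 1 2 \<in> zero_sum k"
    using k by (intro unit_diff_in_zero_sum) auto
  moreover have "unit_diff 1 2 \<noteq> 0"
    by (auto simp: unit_diff_def fun_eq_iff intro!: exI[of _ 1])
  ultimately have "zero_sum k \<noteq> {0}" by blast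
  moreover have "W = {0} \<or> W = zero_sum k"
    if "cvs.subspace W" "W \<subseteq> zero_sum k"
      and "\<And>t. t \<in> carrier (perm_quandle k) \<Longrightarrow> standard_rep k t ` W \<subseteq> W" for W
  proof (rule disjCI)
    assume ne: "W \<noteq> zero_sum k"
    have "v = 0" if "v \<in> W" for v
      using standard_rep_irreducible[of W k v] \<open>cvs.subspace W\<close> \<open>W \<subseteq> zero_sum k\<close> ne that
        \<open>\<And>t. t \<in> carrier (perm_quandle k) \<Longrightarrow> standard_rep k t ` W \<subseteq> W\<close>
      by (force simp: perm_quandle_conj_rack)
    then show "W = {0}"
      using cvs.subspace_0[OF \<open>cvs.subspace W\<close>] by blast
  qed
  ultimately show ?thesis
    using standard_rep_rack_representation
    by (simp add: irreducible_rack_representation_def irreducible_rack_representation_axioms_def)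
qed

lemma standard_rep_strong:
  assumes k: "k \<ge> 3"
  shows "strong_rack_representation (perm_quandle k) cscale (zero_sum k) (standard_rep k)"
proof -
  have "rev_prod (GL cscale (zero_sum k)) (standard_rep k) us = \<one>\<^bsub>GL cscale (zero_sum k)\<^esub>"
    if "stabilizing_family (perm_quandle k) us" for us
    using perm.conj_rack_hom_strong[OF standard_rep_group_hom centralizer_transpositions_trivial[OF k]]
      that
    unfolding perm_quandle_conj_rack by blast
  with standard_rep_rack_representation show ?thesis
    by (simp add: strong_rack_representation_def strong_rack_representation_axioms_def)
qed

theorem mainTheorem5:
  shows "(\<forall>k\<ge>3.
            quandle (perm_quandle k) \<and>
            finite (carrier (perm_quandle k)) \<and>
            involutive_rack (perm_quandle k) \<and>
            connected_rack (perm_quandle k) \<and>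
            (\<exists>V \<rho>. irreducible_rack_representation (perm_quandle k) cscale V \<rho> \<and>
                   strong_rack_representation (perm_quandle k) cscale V \<rho> \<and>
                   vector_space.dim cscale V > 1))
         \<and> \<not> (\<forall>(X :: (nat \<Rightarrow> nat) rack) V \<rho>.
                finite (carrier X) \<and> connected_rack X \<and> involutive_rack X \<and>
                irreducible_rack_representation X cscale V \<rho> \<and>
                strong_rack_representation X cscale V \<rho>
                \<longrightarrow> vector_space.dim cscale V = 1)"
proof (rule conjI)
  have main: "quandle (perm_quandle k) \<and> finite (carrier (perm_quandle k)) \<and>
      involutive_rack (perm_quandle k) \<and> connected_rack (perm_quandle k) \<and>
      irreducible_rack_representation (perm_quandle k) cscale (zero_sum k) (standard_rep k) \<and>
      strong_rack_representation (perm_quandle k) cscale (zero_sum k) (standard_rep k) \<and>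
      cvs.dim (zero_sum k) > 1" if "k \<ge> 3" for k
    using that perm.conj_rack_quandle[of k] finite_perm_quandle perm_quandle_involutive
      perm_quandle_connected standard_rep_irreducible_rack_representation standard_rep_strong
    by (simp add: dim_zero_sum flip: perm_quandle_conj_rack)
  then show "\<forall>k\<ge>3. quandle (perm_quandle k) \<and> finite (carrier (perm_quandle k)) \<and>
      involutive_rack (perm_quandle k) \<and> connected_rack (perm_quandle k) \<and>
      (\<exists>V \<rho>. irreducible_rack_representation (perm_quandle k) cscale V \<rho> \<and>
        strong_rack_representation (perm_quandle k) cscale V \<rho> \<and> cvs.dim V > 1)"
    by blast
  show "\<not> (\<forall>(X :: (nat \<Rightarrow> nat) rack) V \<rho>. finite (carrier X) \<and> connected_rack X \<and>
      involutive_rack X \<and> irreducible_rack_representation X cscale V \<rho> \<and>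
      strong_rack_representation X cscale V \<rho> \<longrightarrow> cvs.dim V = 1)"
    using main[of 3] by (metis order_refl less_irrefl)
qed

end
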